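(* Let $k_1,k_2\ge1$ be integers. For all $n$ with $\min(k_1,k_2)\le n\le k_1+k_2-1$, $$P_{q,\theta}(\overline W_S=n)=\overline P^{(1)}_{q,S}(n)+\overline P^{(0)}_{q,S}(n),$$ where $$\overline P^{(1)}_{q,S}(n)=\theta^{k_1}\prod_{j=1}^{n-k_1}(1-\theta q^{j-1})\sum_{s=1}^{k_1}\Big[\overline I_q(k_1,n-k_1,s)+\overline J_q(k_1,n-k_1,s)\Big]$$ and $$\overline P^{(0)}_{q,S}(n)=\theta^{n-k_2}\prod_{j=1}^{k_2}(1-\theta q^{j-1})\sum_{s=1}^{k_2}\Big[\overline K_q(n-k_2,k_2,s)+\overline L_q(n-k_2,k_2,s)\Big].$$
   Context: Model: fix reals $0\le\theta\le1$ and $0<q<1$. $(X_j)_{j\ge1}$ is a sequence of $\{0,1\}$-valued random variables (1 = success, 0 = failure) with law $P_{q,\theta}$ such that, conditionally on $X_1,\dots,X_{j-1}$ containing exactly $i-1$ zeros, $X_j=0$ with probability $1-\theta q^{i-1}$ and $X_j=1$ with probability $\theta q^{i-1}$. Conventions: $0^0=1$; empty products are 1 and empty sums are 0; when $n<k_1$ (resp. $n<k_2$) the displayed expression for $\overline P^{(1)}_{q,S}(n)$ (resp. $\overline P^{(0)}_{q,S}(n)$) contains only empty sums of tuples and is read as $0$. Waiting times: $N_1$ is the trial at which the $k_1$-th success (in total) occurs and $N_0$ the trial at which the $k_2$-th failure (in total) occurs ($\infty$ if it does not occur). $\overline W_S=\min(N_1,N_0)$ (frequency quotas on both, sooner case);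 $\overline P^{(1)}_{q,S}(n)=P_{q,\theta}(N_1=n,\ N_0>n)$ and $\overline P^{(0)}_{q,S}(n)=P_{q,\theta}(N_0=n,\ N_1>n)$. Combinatorial sums, for integers $u,v$ and $s\ge1$, all variables being positive integers with $\sum x_j=u$ and $\sum y_j=v$ (a family of zero variables consists of the single empty tuple, with sum $0$): - $\overline I_q(u,v,s)=\sum q^{\sum_{j=2}^{s}(y_1+\dots+y_{j-1})x_j}$ over $(x_1,\dots,x_s)$, $(y_1,\dots,y_{s-1})$; - $\overline J_q(u,v,s)=\sum q^{\sum_{j=1}^{s}(y_1+\dots+y_j)x_j}$ over $(x_1,\dots,x_s)$, $(y_1,\dots,y_s)$; - $\overline K_q(u,v,s)=\sum q^{\sum_{j=1}^{s-1}(y_1+\dots+y_j)x_j}$ over $(x_1,\dots,x_{s-1})$, $(y_1,\dots,y_s)$; - $\overline L_q(u,v,s)=\sum q^{\sum_{j=2}^{s}(y_1+\dots+y_{j-1})x_j}$ over $(x_1,\dots,x_s)$, $(y_1,\dots,y_s)$. *)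

theory Defs
  imports "HOL-Probability.Probability" "HOL-Library.Extended_Nat"
begin

text \<open>
  Trials are indexed from 1 (the variable at index 0 is unconstrained); the value 1 is a success,
  the value 0 a failure. The law is prescribed by conditioning on complete histories: a history of
  positive probability with exactly \<open>i - 1\<close> zeros makes the next trial a failure with probability
  \<open>1 - \<theta> * q ^ (i - 1)\<close> and a success with probability \<open>\<theta> * q ^ (i - 1)\<close>. Histories of
  probability 0 (which occur for \<open>\<theta> = 0\<close> and \<open>\<theta> = 1\<close>) carry no condition.
\<close>

locale q_trials = prob_space M for M :: "'a measure" +
  fixes X :: "nat \<Rightarrow> 'a \<Rightarrow> nat" and q \<theta> :: real
  assumes X_measurable: "j \<ge> 1 \<Longrightarrow> X j \<in> measurable M (count_space UNIV)"
    and X_binary: "j \<ge> 1 \<Longrightarrow> \<omega> \<in> space M \<Longrightarrow> X j \<omega> \<in> {0, 1}"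
    and cond_failure:
      "j \<ge> 1 \<Longrightarrow> \<P>(\<omega> in M. \<forall>i\<in>{1..<j}. X i \<omega> = x i) > 0 \<Longrightarrow>
        \<P>(\<omega> in M. X j \<omega> = 0 \<bar> \<forall>i\<in>{1..<j}. X i \<omega> = x i)
          = 1 - \<theta> * q ^ card {i \<in> {1..<j}. x i = 0}"
    and cond_success:
      "j \<ge> 1 \<Longrightarrow> \<P>(\<omega> in M. \<forall>i\<in>{1..<j}. X i \<omega> = x i) > 0 \<Longrightarrow>
        \<P>(\<omega> in M. X j \<omega> = 1 \<bar> \<forall>i\<in>{1..<j}. X i \<omega> = x i)
          = \<theta> * q ^ card {i \<in> {1..<j}. x i = 0}"

text \<open>
  The trial at which the value \<open>b\<close> occurs for the \<open>k\<close>-th time in total (\<open>k \<ge> 1\<close>). There is at most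
  one such trial; if there is none, the infimum of the empty set in \<^typ>\<open>enat\<close> is \<open>\<infinity>\<close>.
\<close>

definition occurrence_time :: "(nat \<Rightarrow> 'a \<Rightarrow> nat) \<Rightarrow> nat \<Rightarrow> nat \<Rightarrow> 'a \<Rightarrow> enat" where
  "occurrence_time X b k \<omega> =
     Inf {enat n | n. n \<ge> 1 \<and> X n \<omega> = b \<and> card {j \<in> {1..n}. X j \<omega> = b} = k}"

definition N1 :: "(nat \<Rightarrow> 'a \<Rightarrow> nat) \<Rightarrow> nat \<Rightarrow> 'a \<Rightarrow> enat" where
  "N1 X k1 = occurrence_time X 1 k1"

definition N0 :: "(nat \<Rightarrow> 'a \<Rightarrow> nat) \<Rightarrow> nat \<Rightarrow> 'a \<Rightarrow> enat" where
  "N0 X k2 = occurrence_time X 0 k2"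

definition W_S :: "(nat \<Rightarrow> 'a \<Rightarrow> nat) \<Rightarrow> nat \<Rightarrow> nat \<Rightarrow> 'a \<Rightarrow> enat" where
  "W_S X k1 k2 \<omega> = min (N1 X k1 \<omega>) (N0 X k2 \<omega>)"

definition P1_S :: "'a measure \<Rightarrow> (nat \<Rightarrow> 'a \<Rightarrow> nat) \<Rightarrow> nat \<Rightarrow> nat \<Rightarrow> nat \<Rightarrow> real" where
  "P1_S M X k1 k2 n = \<P>(\<omega> in M. N1 X k1 \<omega> = enat n \<and> N0 X k2 \<omega> > enat n)"

definition P0_S :: "'a measure \<Rightarrow> (nat \<Rightarrow> 'a \<Rightarrow> nat) \<Rightarrow> nat \<Rightarrow> nat \<Rightarrow> nat \<Rightarrow> real" where
  "P0_S M X k1 k2 n = \<P>(\<omega> in M. N0 X k2 \<omega> = enat n \<and> N1 X k1 \<omega> > enat n)"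

text \<open>
  Tuples \<open>(x\<^sub>1, \<dots>, x\<^sub>s)\<close> of positive integers with sum \<open>u\<close>, as functions on \<open>{1..s}\<close>. For \<open>s = 0\<close>
  there is exactly one tuple, with sum 0. The sum is an integer so that a negative \<open>u\<close>
  leaves no tuples at all.
\<close>

definition pos_tuples :: "nat \<Rightarrow> int \<Rightarrow> (nat \<Rightarrow> nat) set" where
  "pos_tuples s u = {x \<in> {1..s} \<rightarrow>\<^sub>E {1..}. int (\<Sum>j=1..s. x j) = u}"

lemma finite_pos_tuples: "finite (pos_tuples s u)"
proof (rule finite_subset)
  show "pos_tuples s u \<subseteq> {1..s} \<rightarrow>\<^sub>E {..nat u}"
  proof
    fix x assume x: "x \<in> pos_tuples s u"
    have "(\<Sum>j=1..s. x j) = nat u"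
      using x unfolding pos_tuples_def by (metis (mono_tags, lifting) mem_Collect_eq nat_int)
    then have "x j \<le> nat u" if "j \<in> {1..s}" for j
      using member_le_sum[of j "{1..s}" x] that by simp
    then show "x \<in> {1..s} \<rightarrow>\<^sub>E {..nat u}"
      using x by (auto simp: pos_tuples_def PiE_iff)
  qed
qed (simp add: finite_PiE)

definition I_q :: "real \<Rightarrow> int \<Rightarrow> int \<Rightarrow> nat \<Rightarrow> real" where
  "I_q q u v s = (\<Sum>x\<in>pos_tuples s u. \<Sum>y\<in>pos_tuples (s - 1) v.
     q ^ (\<Sum>j=2..s. (\<Sum>i=1..j-1. y i) * x j))"

definition J_q :: "real \<Rightarrow> int \<Rightarrow> int \<Rightarrow> nat \<Rightarrow> real" where
  "J_q q u v s = (\<Sum>x\<in>pos_tuples s u. \<Sum>y\<in>pos_tuples s v.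
     q ^ (\<Sum>j=1..s. (\<Sum>i=1..j. y i) * x j))"

definition K_q :: "real \<Rightarrow> int \<Rightarrow> int \<Rightarrow> nat \<Rightarrow> real" where
  "K_q q u v s = (\<Sum>x\<in>pos_tuples (s - 1) u. \<Sum>y\<in>pos_tuples s v.
     q ^ (\<Sum>j=1..s-1. (\<Sum>i=1..j. y i) * x j))"

definition L_q :: "real \<Rightarrow> int \<Rightarrow> int \<Rightarrow> nat \<Rightarrow> real" where
  "L_q q u v s = (\<Sum>x\<in>pos_tuples s u. \<Sum>y\<in>pos_tuples s v.
     q ^ (\<Sum>j=2..s. (\<Sum>i=1..j-1. y i) * x j))"

end

theory Submission
  imports Defs
begin

text \<open>
  A word of \<open>u\<close> successes and \<open>v\<close> failures occurs with probability
  \<open>\<theta> ^ u * (\<Prod>j=1..v. 1 - \<theta> * q ^ (j - 1)) * q ^ e\<close>, where \<open>e\<close> adds up, over the successes, the number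
  of failures in front of them: the failure factors depend only on how many failures there are,
  and a success after \<open>i\<close> failures contributes \<open>\<theta> * q ^ i\<close>. Cutting a word into its maximal runs,
  with success runs \<open>x\<^sub>1, x\<^sub>2, \<dots>\<close> and failure runs \<open>y\<^sub>1, y\<^sub>2, \<dots>\<close>, turns \<open>e\<close> into the exponents of \<open>I_q\<close>,
  \<open>J_q\<close>, \<open>K_q\<close>, \<open>L_q\<close>. The four sums are sorted by the outer letters of the words: \<open>I_q\<close> has words
  beginning and ending with a success, \<open>J_q\<close> begins with a failure and ends with a success, \<open>K_q\<close>
  begins and ends with a failure, \<open>L_q\<close> begins with a success and ends with a failure.

  The proof does not manipulate words; it shows that both sides obey the same recursion in the last
  letter. On the combinatorial side, a last run either has length 1, and then disappears together
  with the last letter, or it becomes shorter by 1. Summed over the number of runs, this gives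
  \<open>success_end_sum_Suc\<close> and \<open>failure_end_sum_Suc\<close>: removing a last success costs the factor
  \<open>q ^ v\<close>, removing a last failure costs nothing. On the probabilistic side, the number of failures
  is a Markov chain (\<open>prob_failures_next\<close>), with the same recursion for the probability of having
  seen \<open>v\<close> failures after \<open>u + v\<close> trials (\<open>prob_failures\<close>).

  Finally, the \<open>k1\<close>-th success occurs at trial \<open>n\<close> exactly if trial \<open>n\<close> is a success preceded by
  \<open>n - k1\<close> failures, and likewise with the roles exchanged. For \<open>n \<le> k1 + k2 - 1\<close> the first \<open>n\<close> trials
  cannot meet both quotas, so the side conditions \<open>N0 > n\<close> and \<open>N1 > n\<close> hold automatically, and the
  event that the sooner waiting time is \<open>n\<close> splits into the two disjoint cases.
\<close>

section \<open>Shortening the last run of a tuple\<close>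

lemma pos_tuples_neg: "u < 0 \<Longrightarrow> pos_tuples s u = {}"
  unfolding pos_tuples_def using of_nat_0_le_iff by (auto simp del: of_nat_sum simp: not_less[symmetric])

lemma pos_tuples_sum:
  "x \<in> pos_tuples s (int u) \<Longrightarrow> (\<Sum>j=1..s. x j) = u"
  unfolding pos_tuples_def by (metis (mono_tags, lifting) mem_Collect_eq of_nat_eq_iff)

text \<open>Positive entries add up to at least their number.\<close>

lemma pos_tuples_too_long:
  assumes "u < s"
  shows "pos_tuples s (int u) = {}"
proof -
  have False if x: "x \<in> pos_tuples s (int u)" for x
  proof -
    have "x j \<ge> 1" if "j \<in> {1..s}" for j
      using x that by (auto simp: pos_tuples_def PiE_iff)
    then have "(\<Sum>j=1..s. 1) \<le> (\<Sum>j=1..s. x j)"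
      by (intro sum_mono) auto
    moreover have "(\<Sum>j=1..s. x j) = u"
      using x by (rule pos_tuples_sum)
    ultimately show False
      using assms by simp
  qed
  then show ?thesis by blast
qed

lemma pos_tuples_0: "pos_tuples 0 (int u) = (if u = 0 then {\<lambda>_. undefined} else {})"
  by (auto simp: pos_tuples_def)

lemma sum_pos_tuples_last:
  fixes f :: "(nat \<Rightarrow> nat) \<Rightarrow> real"
  shows "(\<Sum>x\<in>pos_tuples (Suc s) (int u). f x) =
    (\<Sum>a\<in>{1..u}. \<Sum>x\<in>pos_tuples s (int (u - a)). f (x(Suc s := a)))"
proof -
  have upd: "(\<Sum>j=1..s. (x(Suc s := a)) j) = (\<Sum>j=1..s. x j)" for x :: "nat \<Rightarrow> nat" and a
    by (intro sum.cong) auto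
  have ext: "x(Suc s := undefined) = x" if "x \<in> pos_tuples s k" for x k
    using that by (auto simp: pos_tuples_def PiE_def extensional_def fun_eq_iff)
  have "(\<Sum>a\<in>{1..u}. \<Sum>x\<in>pos_tuples s (int (u - a)). f (x(Suc s := a))) =
      (\<Sum>(a, x)\<in>Sigma {1..u} (\<lambda>a. pos_tuples s (int (u - a))). f (x(Suc s := a)))"
    by (rule sum.Sigma) (auto simp: finite_pos_tuples)
  also have "\<dots> = (\<Sum>x\<in>pos_tuples (Suc s) (int u). f x)"
  proof (rule sum.reindex_bij_witness[where
        i = "\<lambda>x. (x (Suc s), x(Suc s := undefined))" and j = "\<lambda>(a, x). x(Suc s := a)"])
    fix x assume x: "x \<in> pos_tuples (Suc s) (int u)"
    have sum: "(\<Sum>j=1..s. x j) + x (Suc s) = u"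
      using pos_tuples_sum[OF x] by simp
    have mem: "x \<in> {1..Suc s} \<rightarrow>\<^sub>E {1..}"
      using x by (simp add: pos_tuples_def)
    have "x(Suc s := undefined) \<in> {1..s} \<rightarrow>\<^sub>E {1..}"
      using mem by (auto simp: PiE_def extensional_def Pi_def)
    moreover have "(\<Sum>j=1..s. (x(Suc s := undefined)) j) = u - x (Suc s)"
      unfolding upd using sum by simp
    ultimately have "x(Suc s := undefined) \<in> pos_tuples s (int (u - x (Suc s)))"
      by (simp only: pos_tuples_def mem_Collect_eq)
    moreover have "x (Suc s) \<in> {1..u}"
      using sum mem by (auto simp: PiE_def Pi_def)
    ultimately show "(x (Suc s), x(Suc s := undefined)) \<in>
        Sigma {1..u} (\<lambda>a. pos_tuples s (int (u - a)))"
      by simp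
  next
    fix p assume p: "p \<in> Sigma {1..u} (\<lambda>a. pos_tuples s (int (u - a)))"
    obtain a x where px: "p = (a, x)" by (cases p)
    have a: "a \<in> {1..u}" and x: "x \<in> pos_tuples s (int (u - a))"
      using p px by auto
    have mem: "x(Suc s := a) \<in> {1..Suc s} \<rightarrow>\<^sub>E {1..}"
      using x a by (auto simp: pos_tuples_def PiE_def extensional_def Pi_def le_Suc_eq)
    have "(\<Sum>j=1..Suc s. (x(Suc s := a)) j) = u"
      using pos_tuples_sum[OF x] a upd[of x a] by simp
    then show "(case p of (a, x) \<Rightarrow> x(Suc s := a)) \<in> pos_tuples (Suc s) (int u)"
      using mem px by (simp only: pos_tuples_def mem_Collect_eq prod.case)
    show "((case p of (a, x) \<Rightarrow> x(Suc s := a)) (Suc s),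
        (case p of (a, x) \<Rightarrow> x(Suc s := a))(Suc s := undefined)) = p"
      using ext[OF x] px by simp
  qed auto
  finally show ?thesis by simp
qed

text \<open>
  A last entry equal to 1 is dropped, a larger one is decreased by 1. In both cases the remaining
  total is \<open>u\<close>, which makes this the source of all one-letter recursions below.
\<close>

lemma sum_pos_tuples_Suc:
  fixes f :: "(nat \<Rightarrow> nat) \<Rightarrow> real"
  shows "(\<Sum>x\<in>pos_tuples (Suc s) (int (Suc u)). f x) =
    (\<Sum>x\<in>pos_tuples s (int u). f (x(Suc s := 1))) +
    (\<Sum>x\<in>pos_tuples (Suc s) (int u). f (x(Suc s := Suc (x (Suc s)))))"
proof -
  have "(\<Sum>x\<in>pos_tuples (Suc s) (int (Suc u)). f x) =
      (\<Sum>a\<in>{1..Suc u}. \<Sum>x\<in>pos_tuples s (int (Suc u - a)). f (x(Suc s := a)))"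
    by (rule sum_pos_tuples_last)
  also have "\<dots> = (\<Sum>x\<in>pos_tuples s (int u). f (x(Suc s := 1))) +
      (\<Sum>a\<in>{1..u}. \<Sum>x\<in>pos_tuples s (int (u - a)). f (x(Suc s := Suc a)))"
    unfolding One_nat_def
    by (subst sum.atLeast_Suc_atMost) (simp_all only: sum.shift_bounds_cl_Suc_ivl diff_Suc_Suc
      diff_zero Suc_le_mono le0)
  also have "(\<Sum>a\<in>{1..u}. \<Sum>x\<in>pos_tuples s (int (u - a)). f (x(Suc s := Suc a))) =
      (\<Sum>x\<in>pos_tuples (Suc s) (int u). f (x(Suc s := Suc (x (Suc s)))))"
    by (subst sum_pos_tuples_last) simp
  finally show ?thesis .
qed

lemma sum_upd_cong:
  fixes x :: "nat \<Rightarrow> nat"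
  shows "s < k \<Longrightarrow> (\<Sum>j=m..s. g j * (x(k := a)) j) = (\<Sum>j=m..s. g j * x j)"
    and "s < k \<Longrightarrow> (\<Sum>j=m..s. (x(k := a)) j) = (\<Sum>j=m..s. x j)"
  by (auto intro!: sum.cong)

text \<open>
  Removing the last success of a word with \<open>v\<close> failures lowers the exponent by \<open>v\<close>, because all
  failures precede it. Removing the last failure leaves the exponent unchanged. If the run that
  contained the letter vanishes, then a remaining word ends with the other letter, so that \<open>I_q\<close>
  and \<open>L_q\<close> turn into each other, and so do \<open>J_q\<close> and \<open>K_q\<close>. The index \<open>s\<close> is the larger of the numbers of
  success runs and of failure runs; hence it then drops by 1 exactly if the word begins and ends with the same letter.
\<close>

lemma I_q_Suc:
  "I_q q (int (Suc u)) (int v) (Suc s) =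
    q ^ v * (L_q q (int u) (int v) s + I_q q (int u) (int v) (Suc s))"
proof -
  have *: "(\<Sum>j=2..Suc s. (\<Sum>i=1..j-1. y i) * (x(Suc s := a)) j) =
      (\<Sum>j=2..s. (\<Sum>i=1..j-1. y i) * x j) + v * a"
    if "y \<in> pos_tuples s (int v)" for x y :: "nat \<Rightarrow> nat" and a
  \<comment> \<open>For \<open>s = 0\<close> both sums over \<open>j\<close> are empty, and the empty tuple \<open>y\<close> forces \<open>v = 0\<close>.\<close>
  proof (cases "s = 0")
    case True
    with pos_tuples_sum[OF that] show ?thesis by simp
  next
    case False
    then show ?thesis
      using pos_tuples_sum[OF that] by (simp add: sum_upd_cong)
  qed
  have **: "(\<Sum>j=2..Suc s. (\<Sum>i=1..j-1. y i) * x j) =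
      (\<Sum>j=2..s. (\<Sum>i=1..j-1. y i) * x j) + v * x (Suc s)"
    if "y \<in> pos_tuples s (int v)" for x y :: "nat \<Rightarrow> nat"
    using *[OF that, of x "x (Suc s)"] by simp
  show ?thesis
    unfolding I_q_def L_q_def sum_pos_tuples_Suc diff_Suc_1 distrib_left sum_distrib_left
    by (intro arg_cong2[where f = "(+)"] sum.cong refl; subst *, assumption; (subst **, assumption)?)
       (simp_all only: power_add power_Suc mult_Suc_right mult_1_right mult_1_left ac_simps)
qed

lemma J_q_Suc:
  "J_q q (int (Suc u)) (int v) (Suc s) =
    q ^ v * (K_q q (int u) (int v) (Suc s) + J_q q (int u) (int v) (Suc s))"
proof -
  have *: "(\<Sum>j=1..Suc s. (\<Sum>i=1..j. y i) * (x(Suc s := a)) j) =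
      (\<Sum>j=1..s. (\<Sum>i=1..j. y i) * x j) + v * a"
    if "y \<in> pos_tuples (Suc s) (int v)" for x y :: "nat \<Rightarrow> nat" and a
    using pos_tuples_sum[OF that] by (simp add: sum_upd_cong)
  have **: "(\<Sum>j=1..Suc s. (\<Sum>i=1..j. y i) * x j) =
      (\<Sum>j=1..s. (\<Sum>i=1..j. y i) * x j) + v * x (Suc s)"
    if "y \<in> pos_tuples (Suc s) (int v)" for x y :: "nat \<Rightarrow> nat"
    using *[OF that, of x "x (Suc s)"] by simp
  show ?thesis
    unfolding J_q_def K_q_def sum_pos_tuples_Suc diff_Suc_1 distrib_left sum_distrib_left
    by (intro arg_cong2[where f = "(+)"] sum.cong refl; subst *, assumption; (subst **, assumption)?)
       (simp_all only: power_add power_Suc mult_Suc_right mult_1_right mult_1_left ac_simps)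
qed

lemma K_q_Suc:
  "K_q q (int u) (int (Suc v)) (Suc s) =
    J_q q (int u) (int v) s + K_q q (int u) (int v) (Suc s)"
proof -
  have *: "(\<Sum>j=1..s. (\<Sum>i=1..j. (y(Suc s := b)) i) * x j) =
      (\<Sum>j=1..s. (\<Sum>i=1..j. y i) * x j)" for x y :: "nat \<Rightarrow> nat" and b
    by (intro sum.cong refl arg_cong2[where f = "(*)"]) auto
  show ?thesis
    unfolding K_q_def J_q_def sum_pos_tuples_Suc diff_Suc_1 sum.distrib * ..
qed

lemma L_q_Suc:
  "L_q q (int u) (int (Suc v)) (Suc s) =
    I_q q (int u) (int v) (Suc s) + L_q q (int u) (int v) (Suc s)"
proof -
  have *: "(\<Sum>j=2..Suc s. (\<Sum>i=1..j-1. (y(Suc s := b)) i) * x j) =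
      (\<Sum>j=2..Suc s. (\<Sum>i=1..j-1. y i) * x j)" for x y :: "nat \<Rightarrow> nat" and b
    by (intro sum.cong refl arg_cong2[where f = "(*)"]) auto
  show ?thesis
    unfolding L_q_def I_q_def sum_pos_tuples_Suc diff_Suc_1 sum.distrib * ..
qed

lemma IJKL_vanish:
  "u < s \<Longrightarrow> I_q q (int u) v s = 0"
  "u < s \<Longrightarrow> J_q q (int u) v s = 0"
  "w < s \<Longrightarrow> K_q q z (int w) s = 0"
  "w < s \<Longrightarrow> L_q q z (int w) s = 0"
  by (simp_all add: I_q_def J_q_def K_q_def L_q_def pos_tuples_too_long)

text \<open>
  With 0 runs of each kind there is only the empty word. It is the predecessor of the two words of
  length 1 in the recursions for \<open>K_q\<close> and \<open>I_q\<close>.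
\<close>

lemma JL_q_0:
  "J_q q (int u) (int v) 0 = of_bool (u = 0 \<and> v = 0)"
  "L_q q (int u) (int v) 0 = of_bool (u = 0 \<and> v = 0)"
  by (auto simp: J_q_def L_q_def pos_tuples_0)

section \<open>Generating functions of words\<close>

text \<open>
  The run sums with all possible numbers of runs, for the nonempty words with \<open>u\<close> successes and
  \<open>v\<close> failures that end with a success or with a failure. Together with the empty word they make up
  \<open>word_sum\<close>, a Gaussian binomial coefficient.
\<close>

definition success_end_sum :: "real \<Rightarrow> nat \<Rightarrow> nat \<Rightarrow> real" where
  "success_end_sum q u v =
    (\<Sum>s=1..u. I_q q (int u) (int v) s + J_q q (int u) (int v) s)"

definition failure_end_sum :: "real \<Rightarrow> nat \<Rightarrow> nat \<Rightarrow> real" where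
  "failure_end_sum q u v =
    (\<Sum>s=1..v. K_q q (int u) (int v) s + L_q q (int u) (int v) s)"

definition word_sum :: "real \<Rightarrow> nat \<Rightarrow> nat \<Rightarrow> real" where
  "word_sum q u v = of_bool (u = 0 \<and> v = 0) + success_end_sum q u v + failure_end_sum q u v"

text \<open>
  The recursions change \<open>u\<close> or \<open>v\<close>, and with it the range of the number of runs. A common
  bound \<open>m\<close> makes the sums comparable.
\<close>

lemma success_end_sum_upto:
  assumes "u \<le> m"
  shows "success_end_sum q u v =
    (\<Sum>s<m. I_q q (int u) (int v) (Suc s)) + (\<Sum>s<m. J_q q (int u) (int v) (Suc s))"
proof -
  have "success_end_sum q u v =
      (\<Sum>s=1..m. I_q q (int u) (int v) s + J_q q (int u) (int v) s)"
    unfolding success_end_sum_def using assms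
    by (intro sum.mono_neutral_left) (auto simp: IJKL_vanish)
  then show ?thesis
    by (simp add: sum.distrib sum.atLeast1_atMost_eq)
qed

lemma failure_end_sum_upto:
  assumes "v \<le> m"
  shows "failure_end_sum q u v =
    (\<Sum>s<m. K_q q (int u) (int v) (Suc s)) + (\<Sum>s<m. L_q q (int u) (int v) (Suc s))"
proof -
  have "failure_end_sum q u v =
      (\<Sum>s=1..m. K_q q (int u) (int v) s + L_q q (int u) (int v) s)"
    unfolding failure_end_sum_def using assms
    by (intro sum.mono_neutral_left) (auto simp: IJKL_vanish)
  then show ?thesis
    by (simp add: sum.distrib sum.atLeast1_atMost_eq)
qed

lemma success_end_sum_Suc: "success_end_sum q (Suc u) v = q ^ v * word_sum q u v"
proof -
  define m where "m = Suc (u + v)"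
  \<comment> \<open>The recursion for \<open>I_q\<close> lowers the number of runs in \<open>L_q\<close>. Shifting the index back exposes the
      term with 0 runs, which is the empty word, and loses the term with \<open>m\<close> runs, which is 0.\<close>
  have L: "(\<Sum>s<m. L_q q (int u) (int v) s) =
      of_bool (u = 0 \<and> v = 0) + (\<Sum>s<m. L_q q (int u) (int v) (Suc s))"
    using sum.lessThan_Suc_shift[of "L_q q (int u) (int v)" m]
    by (simp add: JL_q_0 IJKL_vanish m_def)
  have um: "u \<le> m" and vm: "v \<le> m"
    by (simp_all add: m_def)
  have main: "success_end_sum q (Suc u) v = q ^ v *
      ((\<Sum>s<m. L_q q (int u) (int v) s) + (\<Sum>s<m. I_q q (int u) (int v) (Suc s)) +
       (\<Sum>s<m. K_q q (int u) (int v) (Suc s)) + (\<Sum>s<m. J_q q (int u) (int v) (Suc s)))"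
    by (subst success_end_sum_upto[of _ m])
       (simp_all only: m_def I_q_Suc J_q_Suc sum.distrib sum_distrib_left distrib_left
         add.assoc Suc_le_mono le_add1)
  show ?thesis
    unfolding main L word_sum_def success_end_sum_upto[OF um] failure_end_sum_upto[OF vm]
    by (simp only: ac_simps)
qed

lemma failure_end_sum_Suc: "failure_end_sum q u (Suc v) = word_sum q u v"
proof -
  define m where "m = Suc (u + v)"
  \<comment> \<open>The same shift, now for the sum \<open>J_q\<close> coming from \<open>K_q\<close>.\<close>
  have J: "(\<Sum>s<m. J_q q (int u) (int v) s) =
      of_bool (u = 0 \<and> v = 0) + (\<Sum>s<m. J_q q (int u) (int v) (Suc s))"
    using sum.lessThan_Suc_shift[of "J_q q (int u) (int v)" m]
    by (simp add: JL_q_0 IJKL_vanish m_def)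
  have um: "u \<le> m" and vm: "v \<le> m"
    by (simp_all add: m_def)
  have main: "failure_end_sum q u (Suc v) =
      (\<Sum>s<m. J_q q (int u) (int v) s) + (\<Sum>s<m. K_q q (int u) (int v) (Suc s)) +
       (\<Sum>s<m. I_q q (int u) (int v) (Suc s)) + (\<Sum>s<m. L_q q (int u) (int v) (Suc s))"
    by (subst failure_end_sum_upto[of _ m])
       (simp_all only: m_def K_q_Suc L_q_Suc sum.distrib
         add.assoc Suc_le_mono le_add2)
  show ?thesis
    unfolding main J word_sum_def success_end_sum_upto[OF um] failure_end_sum_upto[OF vm]
    by (simp only: ac_simps)
qed

section \<open>The number of failures\<close>

definition failures :: "(nat \<Rightarrow> 'a \<Rightarrow> nat) \<Rightarrow> nat \<Rightarrow> 'a \<Rightarrow> nat" where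
  "failures X n \<omega> = card {i \<in> {1..n}. X i \<omega> = 0}"

lemma failures_0 [simp]: "failures X 0 \<omega> = 0"
  by (simp add: failures_def)

lemma failures_Suc:
  "failures X (Suc n) \<omega> = failures X n \<omega> + of_bool (X (Suc n) \<omega> = 0)"
proof -
  have "{i \<in> {1..Suc n}. X i \<omega> = 0} =
      {i \<in> {1..n}. X i \<omega> = 0} \<union> (if X (Suc n) \<omega> = 0 then {Suc n} else {})"
    by (auto simp: le_Suc_eq)
  then show ?thesis
    by (auto simp: failures_def card_insert_if)
qed

lemma failures_le: "failures X n \<omega> \<le> n"
  unfolding failures_def by (rule order.trans[OF card_mono[of "{1..n}"]]) auto

context q_trials
begin

lemma success_iff_not_failure:
  "j \<ge> 1 \<Longrightarrow> \<omega> \<in> space M \<Longrightarrow> X j \<omega> = 1 \<longleftrightarrow> X j \<omega> \<noteq> 0"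
  using X_binary[of j \<omega>] by auto

lemma failures_measurable [measurable]: "failures X n \<in> measurable M (count_space UNIV)"
proof (induction n)
  case 0
  then show ?case by (simp add: failures_def)
next
  case (Suc n)
  note [measurable] = Suc.IH X_measurable[of "Suc n", simplified]
  show ?case
    unfolding failures_Suc[abs_def] by measurable
qed

text \<open>
  The law is given by conditioning on complete histories. A conditional probability that is the same
  for all histories with \<open>v\<close> failures is also the conditional probability given the number of failures.
\<close>

lemma prob_failures_next:
  "\<P>(\<omega> in M. failures X n \<omega> = v \<and> X (Suc n) \<omega> = 0) =
     \<P>(\<omega> in M. failures X n \<omega> = v) * (1 - \<theta> * q ^ v)" (is ?fail)
  "\<P>(\<omega> in M. failures X n \<omega> = v \<and> X (Suc n) \<omega> = 1) =
     \<P>(\<omega> in M. failures X n \<omega> = v) * (\<theta> * q ^ v)" (is ?succ)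
proof -
  define H where "H = {x \<in> {1..n} \<rightarrow>\<^sub>E {0, 1::nat}. card {i \<in> {1..n}. x i = 0} = v}"
  define E where "E = (\<lambda>x \<omega>. \<forall>i\<in>{1..<Suc n}. X i \<omega> = (x i :: nat))"
  have "finite H"
    unfolding H_def by (intro finite_Collect_conjI disjI1) (simp add: finite_PiE)
  have E_ev [measurable]: "{\<omega> \<in> space M. E x \<omega>} \<in> events" for x
  proof -
    have "{\<omega> \<in> space M. X i \<omega> = x i} \<in> events" if "i \<in> {1..<Suc n}" for i
    proof -
      have [measurable]: "X i \<in> measurable M (count_space UNIV)"
        using that by (intro X_measurable) simp
      show ?thesis by measurable
    qed
    then show ?thesis
      unfolding E_def by (intro sets.sets_Collect_finite_All) auto
  qed
  have [measurable]: "X (Suc n) \<in> measurable M (count_space UNIV)"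
    by (rule X_measurable) simp
  have uniq: "\<exists>!x. x \<in> H \<and> E x \<omega>" if "\<omega> \<in> space M" "failures X n \<omega> = v" for \<omega>
  proof (rule ex1I[of _ "\<lambda>i\<in>{1..n}. X i \<omega>"])
    have "{i \<in> {1..n}. restrict (\<lambda>i. X i \<omega>) {1..n} i = 0} = {i \<in> {1..n}. X i \<omega> = 0}"
      by auto
    then show "(\<lambda>i\<in>{1..n}. X i \<omega>) \<in> H \<and> E (\<lambda>i\<in>{1..n}. X i \<omega>) \<omega>"
      using X_binary that unfolding H_def E_def failures_def by (auto simp: PiE_iff)
  next
    fix x assume "x \<in> H \<and> E x \<omega>"
    then show "x = (\<lambda>i\<in>{1..n}. X i \<omega>)"
      by (auto simp: H_def E_def fun_eq_iff PiE_def extensional_def)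
  qed
  have H_count: "card {i \<in> {1..<Suc n}. x i = 0} = v" if "x \<in> H" for x
    using that unfolding H_def by (simp add: atLeastLessThanSuc_atLeastAtMost)
  have cons: "failures X n \<omega> = v" if "x \<in> H" "E x \<omega>" for x \<omega>
  proof -
    have "{i \<in> {1..n}. X i \<omega> = 0} = {i \<in> {1..n}. x i = 0}"
      using that(2) by (auto simp: E_def)
    then show ?thesis
      using that(1) by (simp add: failures_def H_def)
  qed
  have total: "\<P>(\<omega> in M. failures X n \<omega> = v) = (\<Sum>x\<in>H. \<P>(\<omega> in M. E x \<omega>))"
  proof (rule prob_sum)
    show "AE \<omega> in M. (\<forall>x\<in>H. E x \<omega> \<longrightarrow> failures X n \<omega> = v) \<and>
        (failures X n \<omega> = v \<longrightarrow> (\<exists>!x. x \<in> H \<and> E x \<omega>))"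
      by (rule AE_I2) (intro conjI ballI impI; (rule cons uniq; assumption))
    show "{\<omega> \<in> space M. failures X n \<omega> = v} \<in> events"
      by measurable
  qed (rule \<open>finite H\<close> E_ev)+
  have step: "\<P>(\<omega> in M. failures X n \<omega> = v \<and> X (Suc n) \<omega> = b) =
      \<P>(\<omega> in M. failures X n \<omega> = v) * c"
    if c: "\<And>x. x \<in> H \<Longrightarrow> \<P>(\<omega> in M. E x \<omega>) > 0 \<Longrightarrow> \<P>(\<omega> in M. X (Suc n) \<omega> = b \<bar> E x \<omega>) = c" for b c
  proof -
    have eq: "\<P>(\<omega> in M. E x \<omega> \<and> X (Suc n) \<omega> = b) = \<P>(\<omega> in M. E x \<omega>) * c" if "x \<in> H" for x
    proof (cases "\<P>(\<omega> in M. E x \<omega>) > 0")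
      case True
      with c[OF \<open>x \<in> H\<close> True] show ?thesis
        by (simp add: cond_prob_def field_simps conj_commute)
    next
      \<comment> \<open>A history of probability 0 carries no condition, but both sides vanish.\<close>
      case False
      then have "\<P>(\<omega> in M. E x \<omega>) = 0"
        by (simp add: zero_less_measure_iff)
      moreover have "\<P>(\<omega> in M. E x \<omega> \<and> X (Suc n) \<omega> = b) \<le> \<P>(\<omega> in M. E x \<omega>)"
        by (intro finite_measure_mono) auto
      ultimately show ?thesis
        by (simp add: measure_le_0_iff)
    qed
    have "\<P>(\<omega> in M. failures X n \<omega> = v \<and> X (Suc n) \<omega> = b) =
        (\<Sum>x\<in>H. \<P>(\<omega> in M. E x \<omega> \<and> X (Suc n) \<omega> = b))"
    proof (rule prob_sum)
      show "AE \<omega> in M. (\<forall>x\<in>H. E x \<omega> \<and> X (Suc n) \<omega> = b \<longrightarrow> failures X n \<omega> = v \<and> X (Suc n) \<omega> = b) \<and>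
          (failures X n \<omega> = v \<and> X (Suc n) \<omega> = b \<longrightarrow> (\<exists>!x. x \<in> H \<and> E x \<omega> \<and> X (Suc n) \<omega> = b))"
      proof (rule AE_I2, intro conjI ballI impI)
        fix \<omega> assume "\<omega> \<in> space M" and v: "failures X n \<omega> = v \<and> X (Suc n) \<omega> = b"
        then have "\<exists>!x. x \<in> H \<and> E x \<omega>"
          by (intro uniq) simp_all
        with v show "\<exists>!x. x \<in> H \<and> E x \<omega> \<and> X (Suc n) \<omega> = b"
          by simp
      qed (use cons in blast)+
      show "{\<omega> \<in> space M. failures X n \<omega> = v \<and> X (Suc n) \<omega> = b} \<in> events"
        by measurable
      show "{\<omega> \<in> space M. E x \<omega> \<and> X (Suc n) \<omega> = b} \<in> events" for x
        by measurable
    qed (rule \<open>finite H\<close>)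
    then show ?thesis
      by (simp add: eq total sum_distrib_right)
  qed
  show ?fail
  proof (rule step)
    fix x assume "x \<in> H" "\<P>(\<omega> in M. E x \<omega>) > 0"
    then show "\<P>(\<omega> in M. X (Suc n) \<omega> = 0 \<bar> E x \<omega>) = 1 - \<theta> * q ^ v"
      using cond_failure[of "Suc n" x] H_count[of x] by (simp only: E_def)
  qed
  show ?succ
  proof (rule step)
    fix x assume "x \<in> H" "\<P>(\<omega> in M. E x \<omega>) > 0"
    then show "\<P>(\<omega> in M. X (Suc n) \<omega> = 1 \<bar> E x \<omega>) = \<theta> * q ^ v"
      using cond_success[of "Suc n" x] H_count[of x] by (simp only: E_def)
  qed
qed

lemma prob_failures_Suc:
  "\<P>(\<omega> in M. failures X (Suc n) \<omega> = v) =
     \<P>(\<omega> in M. failures X n \<omega> = v \<and> X (Suc n) \<omega> = 1) +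
     \<P>(\<omega> in M. Suc (failures X n \<omega>) = v \<and> X (Suc n) \<omega> = 0)"
proof -
  have [measurable]: "X (Suc n) \<in> measurable M (count_space UNIV)"
    by (rule X_measurable) simp
  have "{\<omega> \<in> space M. failures X (Suc n) \<omega> = v} =
      {\<omega> \<in> space M. failures X n \<omega> = v \<and> X (Suc n) \<omega> = 1} \<union>
      {\<omega> \<in> space M. Suc (failures X n \<omega>) = v \<and> X (Suc n) \<omega> = 0}"
    by (auto simp: failures_Suc success_iff_not_failure[simplified])
  then show ?thesis
    by (simp only:) (rule finite_measure_Union; auto)
qed

text \<open>
  In the induction on the number of trials, a last success contributes \<open>\<theta> * q ^ v\<close>, of which \<open>q ^ v\<close> is
  absorbed by \<open>success_end_sum_Suc\<close>, and a last failure contributes the last factor of the product.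
\<close>

lemma prob_failures:
  "\<P>(\<omega> in M. failures X (u + v) \<omega> = v) =
    \<theta> ^ u * (\<Prod>j=1..v. 1 - \<theta> * q ^ (j - 1)) * word_sum q u v"
proof (induction "u + v" arbitrary: u v)
  case 0
  then show ?case
    by (simp add: word_sum_def success_end_sum_def failure_end_sum_def prob_space)
next
  case (Suc n)
  have succ: "\<P>(\<omega> in M. failures X n \<omega> = v \<and> X (Suc n) \<omega> = 1) =
      \<theta> ^ u * (\<Prod>j=1..v. 1 - \<theta> * q ^ (j - 1)) * success_end_sum q u v"
  proof (cases u)
    case 0
    then have "n < v" using Suc.hyps by simp
    then have "failures X n \<omega> \<noteq> v" for \<omega>
      using failures_le[of X n \<omega>] by simp
    then show ?thesis
      using 0 by (simp add: success_end_sum_def)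
  next
    case (Suc u')
    then have "n = u' + v" using Suc.hyps by simp
    with Suc.hyps(1)[OF this] Suc show ?thesis
      by (simp add: prob_failures_next success_end_sum_Suc del: One_nat_def)
  qed
  have fail: "\<P>(\<omega> in M. Suc (failures X n \<omega>) = v \<and> X (Suc n) \<omega> = 0) =
      \<theta> ^ u * (\<Prod>j=1..v. 1 - \<theta> * q ^ (j - 1)) * failure_end_sum q u v"
  proof (cases v)
    case 0
    then show ?thesis by (simp add: failure_end_sum_def)
  next
    case (Suc v')
    then have "n = u + v'" using Suc.hyps by simp
    with Suc.hyps(1)[OF this] Suc show ?thesis
      by (simp add: prob_failures_next failure_end_sum_Suc del: One_nat_def)
  qed
  have "word_sum q u v = success_end_sum q u v + failure_end_sum q u v"
    using Suc.hyps(2) by (auto simp: word_sum_def)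
  then show ?case
    unfolding Suc.hyps(2)[symmetric] prob_failures_Suc succ fail by (simp add: distrib_left)
qed

lemma card_successes:
  assumes "\<omega> \<in> space M"
  shows "card {i \<in> {1..n}. X i \<omega> = 1} + failures X n \<omega> = n"
proof -
  have "{1..n} = {i \<in> {1..n}. X i \<omega> = 1} \<union> {i \<in> {1..n}. X i \<omega> = 0}"
    using assms by (auto simp: success_iff_not_failure[simplified])
  then have "n = card ({i \<in> {1..n}. X i \<omega> = 1} \<union> {i \<in> {1..n}. X i \<omega> = 0})"
    by (metis card_atLeastAtMost diff_Suc_1)
  also have "\<dots> = card {i \<in> {1..n}. X i \<omega> = 1} + failures X n \<omega>"
    unfolding failures_def by (rule card_Un_disjoint) auto
  finally show ?thesis by simp
qed

end

section \<open>The waiting times\<close>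

text \<open>
  The number of occurrences of \<open>b\<close> grows strictly at each trial with value \<open>b\<close>, so the infimum is taken
  over at most one trial.
\<close>

lemma occurrence_time_eq_enat:
  "occurrence_time X b k \<omega> = enat n \<longleftrightarrow>
     n \<ge> 1 \<and> X n \<omega> = b \<and> card {j \<in> {1..n}. X j \<omega> = b} = k"
proof -
  define P where "P = (\<lambda>n. n \<ge> 1 \<and> X n \<omega> = b \<and> card {j \<in> {1..n}. X j \<omega> = b} = k)"
  have less: False if "P m" "P m'" "m < m'" for m m'
  proof -
    have "{j \<in> {1..m}. X j \<omega> = b} \<subseteq> {j \<in> {1..m'}. X j \<omega> = b}"
      using that(3) by auto
    moreover have "m' \<in> {j \<in> {1..m'}. X j \<omega> = b}" "m' \<notin> {j \<in> {1..m}. X j \<omega> = b}"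
      using that(2,3) by (auto simp: P_def)
    ultimately have "{j \<in> {1..m}. X j \<omega> = b} \<subset> {j \<in> {1..m'}. X j \<omega> = b}"
      by blast
    then have "card {j \<in> {1..m}. X j \<omega> = b} < card {j \<in> {1..m'}. X j \<omega> = b}"
      by (intro psubset_card_mono) auto
    then show False using that by (simp add: P_def)
  qed
  have uniq: "m = m'" if "P m" "P m'" for m m'
    using less[of m m'] less[of m' m] that by (cases m m' rule: linorder_cases) auto
  have Inf: "occurrence_time X b k \<omega> = Inf {enat n | n. P n}"
    by (simp add: occurrence_time_def P_def)
  have "Inf {enat n | n. P n} = enat n \<longleftrightarrow> P n"
  proof (cases "\<exists>m. P m")
    case True
    then obtain m where m: "P m" ..
    then have "{enat n | n. P n} = {enat m}"
      using uniq by auto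
    then show ?thesis
      using m uniq by auto
  next
    case False
    then have "{enat n | n. P n} = {}" by auto
    then show ?thesis
      using False by (simp add: top_enat_def)
  qed
  then show ?thesis
    unfolding Inf by (simp add: P_def)
qed

lemma card_ge_occurrence_time:
  assumes "occurrence_time X b k \<omega> \<le> enat n"
  shows "k \<le> card {j \<in> {1..n}. X j \<omega> = b}"
proof -
  obtain m where m: "occurrence_time X b k \<omega> = enat m" "m \<le> n"
    using assms by (cases "occurrence_time X b k \<omega>") auto
  then have "k = card {j \<in> {1..m}. X j \<omega> = b}"
    by (simp add: occurrence_time_eq_enat)
  also have "\<dots> \<le> card {j \<in> {1..n}. X j \<omega> = b}"
    using m(2) by (intro card_mono) auto
  finally show ?thesis .
qed

context q_trials
begin

lemma occurrence_times_not_both: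
  assumes "\<omega> \<in> space M" "N1 X k1 \<omega> \<le> enat n" "N0 X k2 \<omega> \<le> enat n"
  shows "k1 + k2 \<le> n"
  using card_ge_occurrence_time[OF assms(2)[unfolded N1_def]]
    card_ge_occurrence_time[OF assms(3)[unfolded N0_def]] card_successes[OF assms(1), of n]
  by (simp add: failures_def)

lemma N1_eq_iff:
  assumes "\<omega> \<in> space M"
  shows "N1 X (Suc u) \<omega> = enat n \<longleftrightarrow>
    Suc u \<le> n \<and> failures X (n - 1) \<omega> = n - Suc u \<and> X n \<omega> = 1"
  using card_successes[OF assms, of n] failures_Suc[of X "n - 1" \<omega>]
  by (cases n) (auto simp: N1_def occurrence_time_eq_enat)

lemma N0_eq_iff:
  "N0 X (Suc v) \<omega> = enat n \<longleftrightarrow>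
    Suc v \<le> n \<and> failures X (n - 1) \<omega> = v \<and> X n \<omega> = 0"
  unfolding N0_def occurrence_time_eq_enat failures_def[symmetric]
  using failures_Suc[of X "n - 1" \<omega>] failures_le[of X n \<omega>] by (cases n) auto

lemma prob_N1:
  "\<P>(\<omega> in M. N1 X (Suc u) \<omega> = enat n) = (if Suc u \<le> n then
     \<theta> ^ Suc u * (\<Prod>j=1..n - Suc u. 1 - \<theta> * q ^ (j - 1)) *
     success_end_sum q (Suc u) (n - Suc u) else 0)"
proof (cases "Suc u \<le> n")
  case True
  then have n: "n - 1 = u + (n - Suc u)" by simp
  have "\<P>(\<omega> in M. N1 X (Suc u) \<omega> = enat n) =
      \<P>(\<omega> in M. failures X (n - 1) \<omega> = n - Suc u \<and> X (Suc (n - 1)) \<omega> = 1)"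
    using True by (intro arg_cong[where f = prob]) (auto simp: N1_eq_iff)
  also have "\<dots> = \<P>(\<omega> in M. failures X (n - 1) \<omega> = n - Suc u) * (\<theta> * q ^ (n - Suc u))"
    by (rule prob_failures_next)
  also have "\<dots> = \<theta> ^ Suc u * (\<Prod>j=1..n - Suc u. 1 - \<theta> * q ^ (j - 1)) *
     success_end_sum q (Suc u) (n - Suc u)"
    unfolding n prob_failures success_end_sum_Suc by simp
  finally show ?thesis using True by simp
next
  case False
  then have "{\<omega> \<in> space M. N1 X (Suc u) \<omega> = enat n} = {}"
    by (auto simp: N1_eq_iff)
  then show ?thesis
    using False by (simp only: measure_empty if_False)
qed

lemma prob_N0:
  "\<P>(\<omega> in M. N0 X (Suc v) \<omega> = enat n) = (if Suc v \<le> n then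
     \<theta> ^ (n - Suc v) * (\<Prod>j=1..Suc v. 1 - \<theta> * q ^ (j - 1)) *
     failure_end_sum q (n - Suc v) (Suc v) else 0)"
proof (cases "Suc v \<le> n")
  case True
  then have n: "n - 1 = (n - Suc v) + v" by simp
  have "\<P>(\<omega> in M. N0 X (Suc v) \<omega> = enat n) =
      \<P>(\<omega> in M. failures X (n - 1) \<omega> = v \<and> X (Suc (n - 1)) \<omega> = 0)"
    using True by (intro arg_cong[where f = prob]) (auto simp: N0_eq_iff)
  also have "\<dots> = \<P>(\<omega> in M. failures X (n - 1) \<omega> = v) * (1 - \<theta> * q ^ v)"
    by (rule prob_failures_next)
  also have "\<dots> = \<theta> ^ (n - Suc v) * (\<Prod>j=1..Suc v. 1 - \<theta> * q ^ (j - 1)) *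
     failure_end_sum q (n - Suc v) (Suc v)"
    unfolding n prob_failures failure_end_sum_Suc by simp
  finally show ?thesis using True by simp
next
  case False
  then have "{\<omega> \<in> space M. N0 X (Suc v) \<omega> = enat n} = {}"
    by (auto simp: N0_eq_iff)
  then show ?thesis
    using False by (simp only: measure_empty if_False)
qed

lemma N_events:
  "{\<omega> \<in> space M. N1 X k \<omega> = enat n} \<in> events"
  "{\<omega> \<in> space M. N0 X k \<omega> = enat n} \<in> events"
proof -
  have eq: "{\<omega> \<in> space M. N1 X k \<omega> = enat n} =
      {\<omega> \<in> space M. n \<ge> 1 \<and> X n \<omega> = 1 \<and> failures X n \<omega> + k = n}"
    "{\<omega> \<in> space M. N0 X k \<omega> = enat n} =
      {\<omega> \<in> space M. n \<ge> 1 \<and> X n \<omega> = 0 \<and> failures X n \<omega> = k}"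
    unfolding N1_def N0_def occurrence_time_eq_enat failures_def[symmetric]
    by (intro Collect_cong conj_cong refl, use card_successes[of _ n] in fastforce) simp
  show "{\<omega> \<in> space M. N1 X k \<omega> = enat n} \<in> events" "{\<omega> \<in> space M. N0 X k \<omega> = enat n} \<in> events"
    unfolding eq
  proof (atomize (full), cases "n \<ge> 1")
    case True
    note [measurable] = X_measurable[OF True]
    show "{\<omega> \<in> space M. n \<ge> 1 \<and> X n \<omega> = 1 \<and> failures X n \<omega> + k = n} \<in> events \<and>
        {\<omega> \<in> space M. n \<ge> 1 \<and> X n \<omega> = 0 \<and> failures X n \<omega> = k} \<in> events"
      by (intro conjI; measurable)
  qed auto
qed

end

theorem theorem5p1:
  fixes M :: "'a measure" and X :: "nat \<Rightarrow> 'a \<Rightarrow> nat"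
    and q \<theta> :: real and k1 k2 n :: nat
  assumes "0 \<le> \<theta>" and "\<theta> \<le> 1" and "0 < q" and "q < 1"
    and "q_trials M X q \<theta>"
    and "k1 \<ge> 1" and "k2 \<ge> 1"
    and "min k1 k2 \<le> n" and "n \<le> k1 + k2 - 1"
  shows "\<P>(\<omega> in M. W_S X k1 k2 \<omega> = enat n) = P1_S M X k1 k2 n + P0_S M X k1 k2 n
    \<and> P1_S M X k1 k2 n =
        \<theta> ^ k1 * (\<Prod>j=1..n-k1. 1 - \<theta> * q ^ (j - 1)) *
        (\<Sum>s=1..k1. I_q q (int k1) (int n - int k1) s + J_q q (int k1) (int n - int k1) s)
    \<and> P0_S M X k1 k2 n =
        \<theta> ^ (n - k2) * (\<Prod>j=1..k2. 1 - \<theta> * q ^ (j - 1)) *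
        (\<Sum>s=1..k2. K_q q (int n - int k2) (int k2) s + L_q q (int n - int k2) (int k2) s)"
proof -
  interpret q_trials M X q \<theta> by fact
  have both: False if "\<omega> \<in> space M" "N1 X k1 \<omega> \<le> enat n" "N0 X k2 \<omega> \<le> enat n" for \<omega>
    using occurrence_times_not_both[OF that] assms by simp
  have E1: "{\<omega> \<in> space M. N1 X k1 \<omega> = enat n \<and> N0 X k2 \<omega> > enat n} =
      {\<omega> \<in> space M. N1 X k1 \<omega> = enat n}"
    using both by (force simp: not_le[symmetric])
  have E0: "{\<omega> \<in> space M. N0 X k2 \<omega> = enat n \<and> N1 X k1 \<omega> > enat n} =
      {\<omega> \<in> space M. N0 X k2 \<omega> = enat n}"
    using both by (force simp: not_le[symmetric])
  have P1: "P1_S M X k1 k2 n = \<P>(\<omega> in M. N1 X k1 \<omega> = enat n)"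
    and P0: "P0_S M X k1 k2 n = \<P>(\<omega> in M. N0 X k2 \<omega> = enat n)"
    unfolding P1_S_def P0_S_def E1 E0 by simp_all
  have "{\<omega> \<in> space M. W_S X k1 k2 \<omega> = enat n} =
      {\<omega> \<in> space M. N1 X k1 \<omega> = enat n} \<union> {\<omega> \<in> space M. N0 X k2 \<omega> = enat n}"
    using both by (auto simp: W_S_def min_def) (metis nle_le order_refl)+
  then have "\<P>(\<omega> in M. W_S X k1 k2 \<omega> = enat n) = P1_S M X k1 k2 n + P0_S M X k1 k2 n"
    unfolding P1 P0 using both by (simp only:) (rule finite_measure_Union; force simp: N_events)
  moreover have "P1_S M X k1 k2 n =
        \<theta> ^ k1 * (\<Prod>j=1..n-k1. 1 - \<theta> * q ^ (j - 1)) *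
        (\<Sum>s=1..k1. I_q q (int k1) (int n - int k1) s + J_q q (int k1) (int n - int k1) s)"
  proof (cases "k1 \<le> n")
    case True
    then show ?thesis
      unfolding P1 using prob_N1[of "k1 - 1" n] \<open>k1 \<ge> 1\<close>
      by (simp add: success_end_sum_def of_nat_diff)
  next
    \<comment> \<open>Fewer than \<open>k1\<close> trials: a negative number of failures admits no tuples, so both sides are 0.\<close>
    case False
    then show ?thesis
      unfolding P1 using prob_N1[of "k1 - 1" n] \<open>k1 \<ge> 1\<close>
      by (simp add: I_q_def J_q_def pos_tuples_neg)
  qed
  moreover have "P0_S M X k1 k2 n =
        \<theta> ^ (n - k2) * (\<Prod>j=1..k2. 1 - \<theta> * q ^ (j - 1)) *
        (\<Sum>s=1..k2. K_q q (int n - int k2) (int k2) s + L_q q (int n - int k2) (int k2) s)"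
  proof (cases "k2 \<le> n")
    case True
    then show ?thesis
      unfolding P0 using prob_N0[of "k2 - 1" n] \<open>k2 \<ge> 1\<close>
      by (simp add: failure_end_sum_def of_nat_diff)
  next
    \<comment> \<open>Likewise, now with a negative number of successes.\<close>
    case False
    then show ?thesis
      unfolding P0 using prob_N0[of "k2 - 1" n] \<open>k2 \<ge> 1\<close>
      by (simp add: K_q_def L_q_def pos_tuples_neg)
  qed
  ultimately show ?thesis by blast
qed

end
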